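(* Let $k\ge 3$ be a fixed integer. Let $T(n,k)$ be the number of onto functions $f:[n]\to[k]$ with $|f^{-1}(\{1\})|<|f^{-1}(\{2\})|<\cdots<|f^{-1}(\{k\})|$, and let $U(n,k)$ be the number of onto functions $f:[n]\to[k]$ with $|f^{-1}(\{1\})|\le|f^{-1}(\{2\})|\le\cdots\le|f^{-1}(\{k\})|$. Then $$\lim_{n\to\infty}\frac{T(n,k)}{S(n,k)}=1\qquad\text{and}\qquad \lim_{n\to\infty}\frac{U(n,k)}{S(n,k)}=1 .$$
   Context: $[m]=\{1,2,\dots,m\}$. $S(n,k)$ is the Stirling number of the second kind, the number of partitions of $[n]$ into $k$ nonempty parts. For $n\ge\frac{(k+4)(k-1)}{2}+1$, $T(n,k)$ is the length of a universal cycle of all onto functions $[n]\to[k]$ with strictly increasing preimage sizes (a universal packing of the partitions of $[n]$ into $k$ parts), and $U(n,k)$ is the length of a universal cycle of all onto functions $[n]\to[k]$ with non-decreasing preimage sizes (a universal covering of these partitions); the length of a universal cycle of a set of strings equals the number of strings in the set. *)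

theory Defs
  imports
    Complex_Main
    "HOL-Library.FuncSet"
    "HOL-Library.Disjoint_Sets"
    "HOL-Combinatorics.Stirling"
begin

text \<open>Maps in \<open>{1..n} \<rightarrow>\<^sub>E {1..k}\<close> are undefined outside \<open>{1..n}\<close>, so each function
  from \<open>{1..n}\<close> to \<open>{1..k}\<close> is counted exactly once.\<close>

definition onto_funs :: "nat \<Rightarrow> nat \<Rightarrow> (nat \<Rightarrow> nat) set" where
  "onto_funs n k = {f \<in> {1..n} \<rightarrow>\<^sub>E {1..k}. f ` {1..n} = {1..k}}"

definition preimage_size :: "nat \<Rightarrow> (nat \<Rightarrow> nat) \<Rightarrow> nat \<Rightarrow> nat" where
  "preimage_size n f i = card {x \<in> {1..n}. f x = i}"

definition T :: "nat \<Rightarrow> nat \<Rightarrow> nat" where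
  "T n k = card {f \<in> onto_funs n k. strict_mono_on {1..k} (preimage_size n f)}"

definition U :: "nat \<Rightarrow> nat \<Rightarrow> nat" where
  "U n k = card {f \<in> onto_funs n k. mono_on {1..k} (preimage_size n f)}"

text \<open>The library introduces \<^const>\<open>Stirling\<close> by its recurrence only; the lemma
  \<open>Stirling_eq_card_partitions\<close> below identifies it with the number of partitions
  of \<open>{1..n}\<close> into \<open>k\<close> nonempty parts.\<close>

definition parts_into :: "'a set \<Rightarrow> nat \<Rightarrow> 'a set set set" where
  "parts_into A k = {P. partition_on A P \<and> card P = k}"

lemma finite_parts_into: "finite A \<Longrightarrow> finite (parts_into A k)"
  unfolding parts_into_def by (rule finite_subset[OF _ finitely_many_partition_on[of A]]) auto

lemma parts_into_insert:
  assumes "finite A" "a \<notin> A"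
  shows "card (parts_into (insert a A) (Suc k)) =
    Suc k * card (parts_into A (Suc k)) + card (parts_into A k)"
proof -
  define g where "g = (\<lambda>(Q, B). insert (insert a B) (Q - {B}))"
  let ?X = "{P \<in> parts_into (insert a A) (Suc k). {a} \<in> P}"
  let ?Y = "{P \<in> parts_into (insert a A) (Suc k). {a} \<notin> P}"
  let ?D = "SIGMA Q:parts_into A (Suc k). Q"
  have fin: "finite (parts_into (insert a A) (Suc k))"
    using assms by (simp add: finite_parts_into)
  have split: "parts_into (insert a A) (Suc k) = ?X \<union> ?Y" by auto
  have cardsplit: "card (parts_into (insert a A) (Suc k)) = card ?X + card ?Y"
    by (subst split, rule card_Un_disjoint) (use fin in auto)

  have X: "bij_betw (insert {a}) (parts_into A k) ?X"
  proof (rule bij_betw_byWitness[where f' = "\<lambda>P. P - {{a}}"])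
    have *: "{a} \<notin> Q" "finite Q" if "Q \<in> parts_into A k" for Q
      using that assms finite_elements[of A Q] by (auto simp: parts_into_def partition_on_def)
    show "\<forall>Q\<in>parts_into A k. insert {a} Q - {{a}} = Q" using * by auto
    show "\<forall>P\<in>?X. insert {a} (P - {{a}}) = P" by auto
    show "insert {a} ` parts_into A k \<subseteq> ?X"
    proof safe
      fix Q assume Q: "Q \<in> parts_into A k"
      have "partition_on (insert a A) (insert {a} Q)"
        using Q assms by (auto simp: parts_into_def partition_on_def disjnt_iff pairwise_insert)
      thus "insert {a} Q \<in> parts_into (insert a A) (Suc k)"
        using Q *[OF Q] by (simp add: parts_into_def)
    qed
    show "(\<lambda>P. P - {{a}}) ` ?X \<subseteq> parts_into A k"
    proof safe
      fix P assume P: "P \<in> parts_into (insert a A) (Suc k)" "{a} \<in> P"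
      have "insert {a} (P - {{a}}) = P" using P by auto
      hence pp: "partition_on (insert a A) (insert {a} (P - {{a}}))"
        using P by (simp add: parts_into_def)
      have dj: "disjnt {a} (\<Union>(P - {{a}}))"
      proof -
        have "disjnt {a} x" if "x \<in> P - {{a}}" for x
          using P that by (intro pairwiseD[of disjnt P]) (auto simp: parts_into_def partition_on_def)
        thus ?thesis by (simp add: disjnt_def)
      qed
      from pp have "partition_on (insert a A - {a}) (P - {{a}})"
        using partition_on_insert[OF dj] by blast
      moreover have "insert a A - {a} = A" using assms by auto
      ultimately show "P - {{a}} \<in> parts_into A k"
        using P by (simp add: parts_into_def)
    qed
  qed
  have Y: "bij_betw g ?D ?Y"
  proof (rule bij_betw_byWitness[where
        f' = "\<lambda>P. ((\<lambda>X. X - {a}) ` P, (THE X. X \<in> P \<and> a \<in> X) - {a})"])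
    have blk: "(THE X. X \<in> P \<and> a \<in> X) = X" if "disjoint P" "X \<in> P" "a \<in> X" for P X
    proof (rule the_equality)
      show "X \<in> P \<and> a \<in> X" using that by simp
      show "Z = X" if "Z \<in> P \<and> a \<in> Z" for Z
        using \<open>disjoint P\<close> \<open>X \<in> P\<close> \<open>a \<in> X\<close> that by (metis disjnt_iff pairwiseD)
    qed
    have Qp: "partition_on (insert a A) (g (Q, B))" "disjoint (g (Q, B))" "{a} \<notin> g (Q, B)"
      "card (g (Q, B)) = card Q" "(\<lambda>X. X - {a}) ` g (Q, B) = Q"
      if Q: "partition_on A Q" "B \<in> Q" for Q B
    proof -
      have na: "a \<notin> X" if "X \<in> Q" for X
        using that Q assms by (auto simp: partition_on_def)
      have f: "finite Q" using finite_elements[OF assms(1) Q(1)] .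
      show p: "partition_on (insert a A) (g (Q, B))"
      proof (rule partition_onI)
        show "\<Union>(g (Q, B)) = insert a A"
          using Q by (auto simp: g_def partition_on_def)
        show "{} \<notin> g (Q, B)" using Q by (auto simp: g_def partition_on_def)
        have dQ: "disjnt x y" if "x \<in> Q" "y \<in> Q" "x \<noteq> y" for x y
          using that Q by (auto simp: partition_on_def pairwise_def)
        show "disjnt p q" if pq: "p \<in> g (Q, B)" "q \<in> g (Q, B)" "p \<noteq> q" for p q
        proof -
          have aux: "disjnt (insert a B) x" if "x \<in> Q - {B}" for x
            using that dQ[of B x] na[of x] Q(2) by auto
          consider "p = insert a B" "q \<in> Q - {B}" | "q = insert a B" "p \<in> Q - {B}"
            | "p \<in> Q" "q \<in> Q"
            using pq unfolding g_def by auto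
          thus ?thesis
            using aux dQ pq(3) by cases (auto simp: disjnt_sym)
        qed
      qed
      thus "disjoint (g (Q, B))" by (simp add: partition_on_def)
      show "{a} \<notin> g (Q, B)"
      proof
        assume "{a} \<in> g (Q, B)"
        moreover have "{a} \<notin> Q" using na by blast
        ultimately have "insert a B = {a}" by (auto simp: g_def)
        hence "B = {}" using na[OF Q(2)] by auto
        thus False using Q by (simp add: partition_on_def)
      qed
      show "card (g (Q, B)) = card Q"
      proof -
        have "insert a B \<notin> Q - {B}" using na by blast
        thus ?thesis using f card_Suc_Diff1[OF f Q(2)]
          by (simp add: g_def card_insert_disjoint del: insert_Diff_single card_Diff_insert)
      qed
      have "(\<lambda>X. X - {a}) ` (Q - {B}) = (\<lambda>X. X) ` (Q - {B})"
        by (rule image_cong) (use na in auto)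
      moreover have "insert a B - {a} = B" using na[OF Q(2)] by auto
      ultimately show "(\<lambda>X. X - {a}) ` g (Q, B) = Q"
        using Q(2) by (auto simp: g_def)
    qed
    show "\<forall>x\<in>?D. ((\<lambda>X. X - {a}) ` g x, (THE X. X \<in> g x \<and> a \<in> X) - {a}) = x"
    proof
      fix x assume x: "x \<in> ?D"
      obtain Q B where xe: "x = (Q, B)" by (cases x)
      have Q: "partition_on A Q" "B \<in> Q" using x xe by (auto simp: parts_into_def)
      have "(THE X. X \<in> g x \<and> a \<in> X) = insert a B"
        using blk[OF Qp(2)[OF Q], of "insert a B"] by (simp add: xe g_def)
      moreover have "a \<notin> B" using Q assms by (auto simp: partition_on_def)
      ultimately show "((\<lambda>X. X - {a}) ` g x, (THE X. X \<in> g x \<and> a \<in> X) - {a}) = x"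
        using Qp(5)[OF Q] by (simp add: xe)
    qed
    show "g ` ?D \<subseteq> ?Y" using Qp by (auto simp: parts_into_def)
    have Pp: "g ((\<lambda>X. X - {a}) ` P, (THE X. X \<in> P \<and> a \<in> X) - {a}) = P \<and>
        ((\<lambda>X. X - {a}) ` P, (THE X. X \<in> P \<and> a \<in> X) - {a}) \<in> ?D"
      if P: "P \<in> ?Y" for P
    proof -
      have pP: "partition_on (insert a A) P" and cP: "card P = Suc k" and nP: "{a} \<notin> P"
        using P by (auto simp: parts_into_def)
      obtain X where X: "X \<in> P" "a \<in> X" using pP by (auto simp: partition_on_def)
      have dP: "disjoint P" using pP by (simp add: partition_on_def)
      have th: "(THE X. X \<in> P \<and> a \<in> X) = X" using blk[OF dP X] .
      have na: "a \<notin> Z" if "Z \<in> P" "Z \<noteq> X" for Z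
        using that X dP by (metis disjnt_iff pairwiseD)
      have "(\<lambda>X. X - {a}) ` (P - {X}) = (\<lambda>X. X) ` (P - {X})"
        by (rule image_cong) (use na in auto)
      hence "(\<lambda>X. X - {a}) ` P = insert (X - {a}) (P - {X})"
        using X(1) by (metis image_ident image_insert insert_Diff)
      note im = this
      have XP: "X - {a} \<notin> P"
      proof
        assume *: "X - {a} \<in> P"
        moreover have "X - {a} \<noteq> X" using X by auto
        ultimately have "disjnt (X - {a}) X" using dP X by (intro pairwiseD[of disjnt P])
        hence "X - {a} = {}" by (auto simp: disjnt_iff)
        thus False using * partition_onD3[OF pP] by metis
      qed
      have "g ((\<lambda>X. X - {a}) ` P, X - {a}) = P"
        unfolding im g_def using X XP by (auto simp: insert_absorb)
      moreover have "partition_on A ((\<lambda>X. X - {a}) ` P)"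
      proof (rule partition_onI)
        show "\<Union>((\<lambda>X. X - {a}) ` P) = A" using pP assms by (auto simp: partition_on_def)
        show "{} \<notin> (\<lambda>X. X - {a}) ` P"
          using pP nP by (auto simp: partition_on_def subset_singleton_iff)
        show "disjnt p q" if pq: "p \<in> (\<lambda>X. X - {a}) ` P" "q \<in> (\<lambda>X. X - {a}) ` P" "p \<noteq> q" for p q
        proof -
          obtain X Y where XY: "X \<in> P" "Y \<in> P" "p = X - {a}" "q = Y - {a}"
            using pq(1,2) by blast
          hence "disjnt X Y" using pq(3) by (intro pairwiseD[OF dP]) auto
          thus ?thesis using XY by (auto simp: disjnt_iff)
        qed
      qed
      moreover have "card ((\<lambda>X. X - {a}) ` P) = Suc k"
      proof -
        have "finite P" using finite_elements[OF _ pP] assms by simp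
        thus ?thesis unfolding im using XP X(1) cP card_Suc_Diff1[of P X] by simp
      qed
      ultimately show ?thesis using X(1) by (simp add: th parts_into_def)
    qed
    show "\<forall>P\<in>?Y. g ((\<lambda>X. X - {a}) ` P, (THE X. X \<in> P \<and> a \<in> X) - {a}) = P"
      using Pp by blast
    show "(\<lambda>P. ((\<lambda>X. X - {a}) ` P, (THE X. X \<in> P \<and> a \<in> X) - {a})) ` ?Y \<subseteq> ?D"
      using Pp by blast
  qed
  have "card ?D = (\<Sum>Q\<in>parts_into A (Suc k). card Q)"
  proof (rule card_SigmaI)
    show "finite (parts_into A (Suc k))" using assms by (simp add: finite_parts_into)
    show "\<forall>Q\<in>parts_into A (Suc k). finite Q"
      using finite_elements[OF assms(1)] by (simp add: parts_into_def)
  qed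
  also have "\<dots> = Suc k * card (parts_into A (Suc k))"
    by (simp add: parts_into_def)
  finally show ?thesis
    using cardsplit bij_betw_same_card[OF X] bij_betw_same_card[OF Y] by simp
qed

lemma card_parts_into: "finite A \<Longrightarrow> card (parts_into A k) = Stirling (card A) k"
proof (induction A arbitrary: k rule: finite_induct)
  case empty
  show ?case by (cases k) (auto simp: parts_into_def partition_on_empty Collect_conv_if)
next
  case (insert a A)
  show ?case
  proof (cases k)
    case 0
    have "finite P" if "partition_on (insert a A) P" for P
      using finite_elements[OF _ that] insert.hyps by simp
    hence "parts_into (insert a A) 0 = {}"
      by (fastforce simp: parts_into_def partition_on_def)
    thus ?thesis using 0 insert.hyps by simp
  next
    case (Suc j)
    thus ?thesis using insert by (simp add: parts_into_insert)
  qed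
qed

lemma Stirling_eq_card_partitions:
  "Stirling n k = card {P. partition_on {1..n} P \<and> card P = k}"
  using card_parts_into[of "{1..n}" k] by (simp add: parts_into_def)

end

theory Submission
  imports Defs
begin

text \<open>Sending a map to its kernel gives \<open>T n k \<le> Stirling n k \<le> U n k\<close>: it is injective on maps
  with strictly increasing sizes, and every partition comes from numbering its blocks by size.
  The difference \<open>U n k - T n k\<close> is at most the number of maps with two preimages of equal size.
  Given that \<open>a\<close> points go to two fixed values, they are split evenly with probability
  \<open>O(1 / sqrt a)\<close> by the central binomial bound; averaging over the binomially distributed \<open>a\<close>
  gives \<open>O(k ^ n / sqrt n)\<close> such maps, which is negligible because
  \<open>Stirling n k \<ge> k ^ (n - k)\<close>.\<close>

section \<open>Central binomial coefficients and even splits of a set\<close>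

text \<open>The absorption identity is applied twice, with the symmetry of the binomial coefficients
  in between.\<close>

lemma Suc_times_central_binomial:
  "Suc m * (2 * Suc m choose Suc m) = 2 * (2 * m + 1) * (2 * m choose m)"
proof -
  have "Suc m * (2 * Suc m choose Suc m) = 2 * Suc m * (Suc (2 * m) choose m)"
    using Suc_times_binomial[of m "Suc (2 * m)"] by simp
  also have "(Suc (2 * m) choose m) = (Suc (2 * m) choose Suc m)"
    using binomial_symmetric[of m "Suc (2 * m)"] by simp
  also have "2 * Suc m * (Suc (2 * m) choose Suc m) = 2 * (2 * m + 1) * (2 * m choose m)"
    using Suc_times_binomial[of m "2 * m"] by simp
  finally show ?thesis .
qed

text \<open>By the recurrence, the left side grows by the factor
  \<open>4 * (2 * m + 3) * (2 * m + 1) / (m + 1)^2\<close> from \<open>m\<close> to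
  \<open>Suc m\<close>. This is at most 16, since
  \<open>(2 * m + 1) * (2 * m + 3) = (2 * m + 2)^2 - 1\<close>. Squaring keeps the estimate in the
  natural numbers.\<close>

lemma central_binomial_sq_upper_bound:
  "(2 * m + 1) * (2 * m choose m)\<^sup>2 \<le> 16 ^ m"
proof (induction m)
  case (Suc m)
  let ?c = "2 * m choose m" and ?d = "2 * Suc m choose Suc m"
  have "(Suc m)\<^sup>2 * ((2 * Suc m + 1) * ?d\<^sup>2) = (2 * m + 3) * (Suc m * ?d)\<^sup>2"
    by (simp add: power_mult_distrib del: binomial_Suc_Suc mult_Suc)
  also have "\<dots> = 4 * ((2 * m + 3) * (2 * m + 1)) * ((2 * m + 1) * ?c\<^sup>2)"
    unfolding Suc_times_central_binomial by (simp add: power2_eq_square algebra_simps)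
  also have "\<dots> \<le> 4 * (4 * (Suc m)\<^sup>2) * 16 ^ m"
    by (rule mult_le_mono[OF _ Suc.IH]) (simp add: power2_eq_square algebra_simps)
  also have "\<dots> = (Suc m)\<^sup>2 * 16 ^ Suc m"
    by simp
  finally show ?case
    by (simp del: power_Suc binomial_Suc_Suc mult_Suc mult_Suc_right)
qed simp

text \<open>For \<open>card A = 2 * m\<close> the count is the central binomial coefficient, and the
  bound is the square root of the preceding one; for odd \<open>card A\<close> there are no such
  subsets.\<close>

lemma card_half_subsets_le:
  assumes "finite A"
  shows "real (card {B. B \<subseteq> A \<and> 2 * card B = card A}) \<le> 2 ^ card A / sqrt (real (card A) + 1)"
proof (cases "even (card A)")
  case True
  then obtain m where m: "card A = 2 * m" by blast
  have "{B. B \<subseteq> A \<and> 2 * card B = card A} = {B. B \<subseteq> A \<and> card B = m}"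
    using m by auto
  hence c: "card {B. B \<subseteq> A \<and> 2 * card B = card A} = (2 * m choose m)"
    using n_subsets[OF assms, of m] m by simp
  have "real ((2 * m + 1) * (2 * m choose m)\<^sup>2) \<le> real (16 ^ m)"
    using central_binomial_sq_upper_bound[of m] by (simp only: of_nat_le_iff)
  moreover have "(4 ^ m)\<^sup>2 = (16::real) ^ m"
    by (simp add: power2_eq_square flip: power_mult_distrib)
  ultimately have "sqrt ((real (2 * m) + 1) * (real (2 * m choose m))\<^sup>2) \<le> sqrt ((4 ^ m)\<^sup>2)"
    by (intro real_sqrt_le_mono) (simp add: algebra_simps)
  hence "sqrt (real (2 * m) + 1) * real (2 * m choose m) \<le> 4 ^ m"
    by (simp add: real_sqrt_mult)
  moreover have "(4::real) ^ m = 2 ^ (2 * m)"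
    by (simp add: power_mult)
  ultimately show ?thesis
    unfolding c unfolding m by (simp add: field_simps)
next
  case False
  hence "{B. B \<subseteq> A \<and> 2 * card B = card A} = {}"
    by (metis (mono_tags, lifting) Collect_empty_eq dvd_triv_left)
  thus ?thesis by (simp only: card.empty) simp
qed

section \<open>Binomial averages of \<open>1 / (a + 1)\<close> and
  \<open>1 / sqrt (a + 1)\<close>\<close>

lemma sum_Pow_card:
  fixes g :: "nat \<Rightarrow> 'b::semiring_1"
  assumes "finite S"
  shows "(\<Sum>A\<in>Pow S. g (card A)) = (\<Sum>a\<le>card S. of_nat (card S choose a) * g a)"
proof -
  have "(\<Sum>A\<in>Pow S. g (card A)) = (\<Sum>a\<le>card S. \<Sum>A\<in>{A \<in> Pow S. card A = a}. g (card A))"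
    by (rule sum.group[symmetric]) (use assms card_mono in auto)
  also have "\<dots> = (\<Sum>a\<le>card S. of_nat (card S choose a) * g a)"
    using assms by (intro sum.cong refl) (simp add: n_subsets)
  finally show ?thesis .
qed

text \<open>The weight \<open>1 / (a + 1)\<close> is absorbed by
  \<open>(n choose a) / (a + 1) = (n + 1 choose a + 1) / (n + 1)\<close>.\<close>

lemma binomial_sum_div_Suc_le:
  fixes p q :: real
  assumes "p > 0" "q \<ge> 0"
  shows "(\<Sum>a\<le>n. real (n choose a) * (p ^ a * q ^ (n - a) / (real a + 1)))
    \<le> (p + q) ^ Suc n / (p * (real n + 1))"
proof -
  have "p * (real n + 1) * (real (n choose a) * (p ^ a * q ^ (n - a) / (real a + 1)))
      = real (Suc n choose Suc a) * p ^ Suc a * q ^ (Suc n - Suc a)" for a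
  proof -
    have "real (Suc a) * real (Suc n choose Suc a) = real (Suc n) * real (n choose a)"
      using Suc_times_binomial[of a n] by (metis of_nat_mult)
    hence "real (Suc n choose Suc a) = (real n + 1) * real (n choose a) / (real a + 1)"
      by (simp add: field_simps del: binomial_Suc_Suc)
    thus ?thesis by (simp del: binomial_Suc_Suc)
  qed
  hence "p * (real n + 1) * (\<Sum>a\<le>n. real (n choose a) * (p ^ a * q ^ (n - a) / (real a + 1)))
      = (\<Sum>a\<le>n. real (Suc n choose Suc a) * p ^ Suc a * q ^ (Suc n - Suc a))"
    by (simp only: sum_distrib_left)
  \<comment> \<open>The full expansion of the power has just one further term, \<open>b = 0\<close>,
    and it is nonnegative.\<close>
  also have "\<dots> \<le> (\<Sum>b\<le>Suc n. real (Suc n choose b) * p ^ b * q ^ (Suc n - b))"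
    unfolding sum.atMost_Suc_shift using assms by simp
  also have "\<dots> = (p + q) ^ Suc n"
    by (rule binomial_ring[symmetric])
  finally show ?thesis
    using assms by (subst pos_le_divide_eq) (simp_all add: mult.commute)
qed

text \<open>The bound on the average of \<open>1 / (a + 1)\<close> carries over to its square root
  at the cost of a constant: each \<open>1 / sqrt (a + 1)\<close> is compared with the common scale
  \<open>e = 1 / sqrt (n + 1)\<close>, which is the order expected of the average.\<close>

lemma binomial_sum_div_sqrt_le:
  fixes p q :: real
  assumes "p > 0" "q \<ge> 0"
  shows "(\<Sum>a\<le>n. real (n choose a) * (p ^ a * q ^ (n - a) / sqrt (real a + 1)))
    \<le> (p + q) ^ n * (1 + (p + q) / (4 * p)) / sqrt (real n + 1)"
proof -
  define e where "e = 1 / sqrt (real n + 1)"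
  have e: "e > 0" "e * e = 1 / (real n + 1)"
    by (simp_all add: e_def)
  \<comment> \<open>AM-GM in the form \<open>s \<le> e + s\<^sup>2 / (4 e)\<close>, a stand-in for Cauchy-Schwarz\<close>
  have amgm: "1 / sqrt (real a + 1) \<le> e + 1 / (real a + 1) / (4 * e)" for a
  proof -
    define s where "s = 1 / sqrt (real a + 1)"
    have "s\<^sup>2 = 1 / (real a + 1)"
      by (simp add: s_def power_divide)
    moreover have "s \<le> e + s\<^sup>2 / (4 * e)"
      using e zero_le_power2[of "s - 2 * e"] by (simp add: field_simps power2_eq_square)
    ultimately show ?thesis by (simp add: s_def)
  qed
  have "(\<Sum>a\<le>n. real (n choose a) * (p ^ a * q ^ (n - a) / sqrt (real a + 1)))
      \<le> (\<Sum>a\<le>n. e * (real (n choose a) * p ^ a * q ^ (n - a))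
          + 1 / (4 * e) * (real (n choose a) * (p ^ a * q ^ (n - a) / (real a + 1))))"
  proof (rule sum_mono)
    fix a
    let ?w = "real (n choose a) * p ^ a * q ^ (n - a)"
    have "?w * (1 / sqrt (real a + 1)) \<le> ?w * (e + 1 / (real a + 1) / (4 * e))"
      using assms by (intro mult_left_mono amgm) simp_all
    thus "real (n choose a) * (p ^ a * q ^ (n - a) / sqrt (real a + 1))
      \<le> e * ?w + 1 / (4 * e) * (real (n choose a) * (p ^ a * q ^ (n - a) / (real a + 1)))"
      by (simp add: algebra_simps)
  qed
  also have "\<dots> = e * (p + q) ^ n
      + 1 / (4 * e) * (\<Sum>a\<le>n. real (n choose a) * (p ^ a * q ^ (n - a) / (real a + 1)))"
    by (simp only: sum.distrib binomial_ring flip: sum_distrib_left)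
  also have "\<dots> \<le> e * (p + q) ^ n + 1 / (4 * e) * ((p + q) ^ Suc n / (p * (real n + 1)))"
    using e by (intro add_left_mono mult_left_mono binomial_sum_div_Suc_le assms) simp
  also have "(p + q) ^ Suc n / (p * (real n + 1)) = (p + q) ^ n * ((p + q) / p) * (e * e)"
    by (simp add: e)
  also have "e * (p + q) ^ n + 1 / (4 * e) * ((p + q) ^ n * ((p + q) / p) * (e * e))
      = (p + q) ^ n * (1 + (p + q) / (4 * p)) * e"
    using e(1) assms by (simp add: field_simps)
  finally show ?thesis by (simp add: e_def)
qed

section \<open>Maps with two preimages of equal size\<close>

text \<open>A map is recovered from the set of points sent to \<open>{i, j}\<close>, the subset sent to \<open>i\<close>,
  and the restriction to the remaining points.\<close>

lemma card_equal_preimage_sizes_le: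
  assumes ij: "i \<in> {1..k}" "j \<in> {1..k}" "i \<noteq> j"
  shows "real (card {f \<in> {1..n} \<rightarrow>\<^sub>E {1..k}. preimage_size n f i = preimage_size n f j})
    \<le> real k ^ n * (1 + real k / 8) / sqrt (real n + 1)"
proof -
  let ?F = "{f \<in> {1..n} \<rightarrow>\<^sub>E {1..k}. preimage_size n f i = preimage_size n f j}"
  let ?W = "\<lambda>A. {B. B \<subseteq> A \<and> 2 * card B = card A} \<times> (({1..n} - A) \<rightarrow>\<^sub>E ({1..k} - {i, j}))"
  define h where "h = (\<lambda>f::nat \<Rightarrow> nat. ({x \<in> {1..n}. f x \<in> {i, j}}, {x \<in> {1..n}. f x = i},
    restrict f {x \<in> {1..n}. f x \<notin> {i, j}}))"
  have k2: "k \<ge> 2" using ij by auto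
  have "inj_on h ?F"
  proof (rule inj_onI)
    fix f g assume f: "f \<in> ?F" and g: "g \<in> ?F" and eq: "h f = h g"
    show "f = g"
    proof (rule PiE_ext)
      show "f \<in> {1..n} \<rightarrow>\<^sub>E {1..k}" "g \<in> {1..n} \<rightarrow>\<^sub>E {1..k}" using f g by auto
      fix x assume x: "x \<in> {1..n}"
      have "f x \<in> {i, j} \<longleftrightarrow> g x \<in> {i, j}" "f x = i \<longleftrightarrow> g x = i"
        using eq x by (auto simp: h_def set_eq_iff)
      moreover have "f x = g x" if "f x \<notin> {i, j}" "g x \<notin> {i, j}"
      proof -
        have "restrict f {x \<in> {1..n}. f x \<notin> {i, j}} x = restrict g {x \<in> {1..n}. g x \<notin> {i, j}} x"
          using eq by (simp add: h_def)
        thus ?thesis using that x by simp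
      qed
      ultimately show "f x = g x" by auto
    qed
  qed
  moreover have "h ` ?F \<subseteq> (SIGMA A:Pow {1..n}. ?W A)"
  proof
    fix y assume "y \<in> h ` ?F"
    then obtain f where f: "f \<in> ?F" and y: "y = h f" by blast
    have "{x \<in> {1..n}. f x \<in> {i, j}} = {x \<in> {1..n}. f x = i} \<union> {x \<in> {1..n}. f x = j}"
      by auto
    moreover have "card \<dots> = preimage_size n f i + preimage_size n f j"
      unfolding preimage_size_def using ij by (subst card_Un_disjoint) auto
    ultimately have "2 * card {x \<in> {1..n}. f x = i} = card {x \<in> {1..n}. f x \<in> {i, j}}"
      using f by (simp add: preimage_size_def)
    moreover have "{x \<in> {1..n}. f x \<notin> {i, j}} = {1..n} - {x \<in> {1..n}. f x \<in> {i, j}}"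
      by auto
    ultimately show "y \<in> (SIGMA A:Pow {1..n}. ?W A)"
      using f unfolding y h_def by (auto simp: PiE_iff)
  qed
  moreover have fin: "finite (?W A)" if "A \<in> Pow {1..n}" for A
    using that finite_subset[of A "{1..n}"] by (intro finite_cartesian_product finite_PiE) auto
  hence "finite (SIGMA A:Pow {1..n}. ?W A)"
    by (intro finite_SigmaI[OF _ fin]) simp_all
  ultimately have "card ?F \<le> card (SIGMA A:Pow {1..n}. ?W A)"
    by (rule card_inj_on_le)
  also have "\<dots> = (\<Sum>A\<in>Pow {1..n}. card (?W A))"
    by (intro card_SigmaI) (use fin in auto)
  finally have "real (card ?F) \<le> (\<Sum>A\<in>Pow {1..n}. real (card (?W A)))"
    by (simp only: of_nat_le_iff flip: of_nat_sum)
  also have "\<dots> \<le> (\<Sum>A\<in>Pow {1..n}. 2 ^ card A * real (k - 2) ^ (n - card A) / sqrt (real (card A) + 1))"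
  proof (rule sum_mono)
    fix A assume A: "A \<in> Pow {1..n}"
    hence fA: "finite A" using finite_subset by blast
    have "card ({1..k} - {i, j}) = k - 2"
      using ij by (subst card_Diff_subset) auto
    moreover have "card ({1..n} - A) = n - card A"
      using A fA by (subst card_Diff_subset) auto
    ultimately have "card (?W A)
        = card {B. B \<subseteq> A \<and> 2 * card B = card A} * (k - 2) ^ (n - card A)"
      by (simp add: card_cartesian_product card_funcsetE)
    thus "real (card (?W A)) \<le> 2 ^ card A * real (k - 2) ^ (n - card A) / sqrt (real (card A) + 1)"
      using mult_right_mono[OF card_half_subsets_le[OF fA], of "real (k - 2) ^ (n - card A)"]
      by simp
  qed
  also have "\<dots> = (\<Sum>a\<le>n. real (n choose a) * (2 ^ a * real (k - 2) ^ (n - a) / sqrt (real a + 1)))"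
    using sum_Pow_card[of "{1..n}" "\<lambda>a. 2 ^ a * real (k - 2) ^ (n - a) / sqrt (real a + 1)"]
    by simp
  \<comment> \<open>Two of the \<open>k\<close> values are singled out, so \<open>p = 2\<close> and
    \<open>q = k - 2\<close>; then \<open>p + q = k\<close>, and \<open>(p + q) / (4 * p)\<close> is
    \<open>k / 8\<close>.\<close>
  also have "\<dots> \<le> (2 + real (k - 2)) ^ n * (1 + (2 + real (k - 2)) / (4 * 2)) / sqrt (real n + 1)"
    by (rule binomial_sum_div_sqrt_le) auto
  also have "2 + real (k - 2) = real k"
    using k2 by simp
  finally show ?thesis by simp
qed

section \<open>A lower bound for Stirling numbers\<close>

text \<open>Only the first summand of the recurrence is kept: starting from \<open>k\<close>
  singletons, each of \<open>m\<close> further points joins any of the \<open>k\<close>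
  blocks.\<close>

lemma Stirling_ge_power: "k ^ m \<le> Stirling (k + m) k"
proof (induction m)
  case (Suc m)
  have "k ^ Suc m \<le> k * Stirling (k + m) k"
    using Suc.IH by simp
  also have "\<dots> \<le> Stirling (k + Suc m) k"
    by (cases k) auto
  finally show ?case .
qed simp

section \<open>Kernels of onto maps, and comparison of \<open>T\<close> and \<open>U\<close> with
  \<open>Stirling\<close>\<close>

text \<open>The fibres are indexed by \<open>{1..k}\<close>, so a value that is not attained would
  contribute an empty block; for onto maps this is the usual kernel.\<close>

definition kernel_partition :: "nat \<Rightarrow> nat \<Rightarrow> (nat \<Rightarrow> nat) \<Rightarrow> nat set set" where
  "kernel_partition n k f = (\<lambda>i. {x \<in> {1..n}. f x = i}) ` {1..k}"

lemma inj_on_fibres: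
  assumes "f \<in> onto_funs n k"
  shows "inj_on (\<lambda>i. {x \<in> {1..n}. f x = i}) {1..k}"
proof (rule inj_onI)
  fix i j assume ij: "i \<in> {1..k}" and eq: "{x \<in> {1..n}. f x = i} = {x \<in> {1..n}. f x = j}"
  have "i \<in> f ` {1..n}" using assms ij by (simp add: onto_funs_def)
  then obtain x where x: "x \<in> {x \<in> {1..n}. f x = i}" by blast
  hence "x \<in> {x \<in> {1..n}. f x = j}" unfolding eq .
  thus "i = j" using x by simp
qed

lemma kernel_partition_in_parts_into:
  assumes f: "f \<in> onto_funs n k"
  shows "kernel_partition n k f \<in> parts_into {1..n} k"
proof -
  have im: "f ` {1..n} = {1..k}" using f by (simp add: onto_funs_def)
  have "partition_on {1..n} (kernel_partition n k f)"
  proof (rule partition_onI)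
    show "\<Union>(kernel_partition n k f) = {1..n}"
      using im by (auto simp: kernel_partition_def)
    show "{} \<notin> kernel_partition n k f"
    proof
      assume "{} \<in> kernel_partition n k f"
      then obtain i where i: "i \<in> {1..k}" "{x \<in> {1..n}. f x = i} = {}"
        unfolding kernel_partition_def by (metis (no_types, lifting) imageE)
      have "i \<in> f ` {1..n}" using i im by simp
      thus False using i(2) by auto
    qed
  qed (auto simp: kernel_partition_def disjnt_iff)
  moreover have "card (kernel_partition n k f) = k"
    unfolding kernel_partition_def using card_image[OF inj_on_fibres[OF f]] by simp
  ultimately show ?thesis by (simp add: parts_into_def)
qed

text \<open>For strictly increasing sizes, the value at \<open>x\<close> is the rank by size of the block of \<open>x\<close>,
  so the map is determined by its kernel.\<close>

lemma value_eq_rank_of_block: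
  assumes f: "f \<in> onto_funs n k" and mono: "strict_mono_on {1..k} (preimage_size n f)"
    and x: "x \<in> {1..n}" and B: "B \<in> kernel_partition n k f" "x \<in> B"
  shows "f x = card {C \<in> kernel_partition n k f. card C \<le> card B}"
proof -
  let ?b = "\<lambda>i. {x \<in> {1..n}. f x = i}"
  have fx: "f x \<in> {1..k}" using f x by (auto simp: onto_funs_def)
  have B': "B = ?b (f x)" using B by (auto simp: kernel_partition_def)
  have le: "card (?b i) \<le> card (?b (f x)) \<longleftrightarrow> i \<le> f x" if "i \<in> {1..k}" for i
    using strict_mono_on_less_eq[OF mono that fx] by (simp add: preimage_size_def)
  have "{C \<in> kernel_partition n k f. card C \<le> card B} = ?b ` {i \<in> {1..k}. i \<le> f x}"
    unfolding kernel_partition_def B' using le by blast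
  also have "{i \<in> {1..k}. i \<le> f x} = {1..f x}"
    using fx by auto
  also have "card (?b ` {1..f x}) = f x"
    using fx by (subst card_image[OF inj_on_subset[OF inj_on_fibres[OF f]]]) auto
  finally show ?thesis by simp
qed

lemma inj_on_kernel_partition:
  "inj_on (kernel_partition n k) {f \<in> onto_funs n k. strict_mono_on {1..k} (preimage_size n f)}"
proof (rule inj_onI)
  fix f g
  assume f: "f \<in> {f \<in> onto_funs n k. strict_mono_on {1..k} (preimage_size n f)}"
    and g: "g \<in> {f \<in> onto_funs n k. strict_mono_on {1..k} (preimage_size n f)}"
    and eq: "kernel_partition n k f = kernel_partition n k g"
  show "f = g"
  proof (rule PiE_ext)
    show "f \<in> {1..n} \<rightarrow>\<^sub>E {1..k}" "g \<in> {1..n} \<rightarrow>\<^sub>E {1..k}"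
      using f g by (auto simp: onto_funs_def)
    fix x assume x: "x \<in> {1..n}"
    have "\<Union>(kernel_partition n k f) = {1..n}"
      using f kernel_partition_in_parts_into[of f n k] by (simp add: parts_into_def partition_on_def)
    then obtain B where "B \<in> kernel_partition n k f" "x \<in> B"
      using x by blast
    thus "f x = g x"
      using f g x eq value_eq_rank_of_block[of f n k x B] value_eq_rank_of_block[of g n k x B] by simp
  qed
qed

lemma finite_onto_funs: "finite (onto_funs n k)"
  by (rule finite_subset[OF _ finite_PiE[of "{1..n}" "\<lambda>_. {1..k}"]]) (auto simp: onto_funs_def)

lemma T_le_Stirling: "T n k \<le> Stirling n k"
proof -
  have "T n k \<le> card (parts_into {1..n} k)"
    unfolding T_def
    by (rule card_inj_on_le[OF inj_on_kernel_partition])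
      (use kernel_partition_in_parts_into in \<open>auto simp: finite_parts_into\<close>)
  thus ?thesis by (simp add: card_parts_into)
qed

text \<open>The blocks are listed in order of size and each point is sent to the position of its
  block. Blocks of equal size may be listed in any order, so the map need not be unique.\<close>

lemma ex_mono_onto_fun_of_partition:
  assumes P: "P \<in> parts_into {1..n} k"
  shows "\<exists>f \<in> onto_funs n k. mono_on {1..k} (preimage_size n f) \<and> kernel_partition n k f = P"
proof -
  have part: "partition_on {1..n} P" and cP: "card P = k"
    using P by (auto simp: parts_into_def)
  have "finite P" using finite_elements[OF _ part] by simp
  then obtain xs where xs: "set xs = P" "distinct xs"
    using finite_distinct_list by blast
  define ys where "ys = sort_key card xs"
  have ys: "set ys = P" "distinct ys" "sorted (map card ys)"
    using xs by (simp_all add: ys_def)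
  have len: "length ys = k"
    using ys cP distinct_card by metis
  \<comment> \<open>List positions start at 0 and values at 1. Truncated subtraction would identify
    the indices 0 and 1, but only indices in \<open>{1..k}\<close> occur.\<close>
  define b where "b = (\<lambda>i. ys ! (i - 1))"
  have b_in: "b i \<in> P" if "i \<in> {1..k}" for i
    using that ys len by (auto simp: b_def intro!: nth_mem)
  have b_mono: "card (b i) \<le> card (b j)" if "i \<in> {1..k}" "j \<in> {1..k}" "i \<le> j" for i j
    using sorted_nth_mono[OF ys(3), of "i - 1" "j - 1"] that len by (auto simp: b_def)
  have b_inj: "i = j" if "i \<in> {1..k}" "j \<in> {1..k}" "b i = b j" for i j
  proof -
    have "i - 1 < length ys" "j - 1 < length ys" using that len by auto
    hence "i - 1 = j - 1"
      using nth_eq_iff_index_eq[OF ys(2)] that by (simp add: b_def)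
    thus ?thesis using that by auto
  qed
  have b_surj: "\<exists>i\<in>{1..k}. b i = B" if "B \<in> P" for B
  proof -
    obtain m where "m < length ys" "ys ! m = B"
      using \<open>B \<in> P\<close> unfolding ys(1)[symmetric] in_set_conv_nth by blast
    thus ?thesis using len by (intro bexI[of _ "Suc m"]) (auto simp: b_def)
  qed
  have Un: "\<Union>P = {1..n}" using part by (simp add: partition_on_def)
  hence "\<forall>x\<in>{1..n}. \<exists>i. i \<in> {1..k} \<and> x \<in> b i"
    using b_surj by blast
  then obtain g where g: "\<forall>x\<in>{1..n}. g x \<in> {1..k} \<and> x \<in> b (g x)"
    by metis
  \<comment> \<open>Restriction makes the map undefined outside \<open>{1..n}\<close>, as membership
    in \<open>onto_funs\<close> demands.\<close>
  define f where "f = restrict g {1..n}"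
  have f: "f x \<in> {1..k}" "x \<in> b (f x)" if "x \<in> {1..n}" for x
    using that g by (auto simp: f_def)
  have fib: "{x \<in> {1..n}. f x = i} = b i" if i: "i \<in> {1..k}" for i
  proof
    show "{x \<in> {1..n}. f x = i} \<subseteq> b i" using f by auto
    show "b i \<subseteq> {x \<in> {1..n}. f x = i}"
    proof
      fix x assume x: "x \<in> b i"
      have xn: "x \<in> {1..n}" using x b_in[OF i] Un by blast
      have "\<not> disjnt (b (f x)) (b i)" using f(2)[OF xn] x by (auto simp: disjnt_iff)
      hence "b (f x) = b i"
        using partition_onD2[OF part] b_in[OF i] b_in[OF f(1)[OF xn]] by (metis pairwiseD)
      thus "x \<in> {x \<in> {1..n}. f x = i}" using b_inj[OF f(1)[OF xn] i] xn by simp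
    qed
  qed
  have "{1..k} \<subseteq> f ` {1..n}"
  proof
    fix i assume i: "i \<in> {1..k}"
    have "b i \<noteq> {}" using b_in[OF i] partition_onD3[OF part] by metis
    thus "i \<in> f ` {1..n}" unfolding fib[OF i, symmetric] by auto
  qed
  hence "f \<in> onto_funs n k"
    using f(1) by (auto simp: onto_funs_def f_def)
  moreover have "mono_on {1..k} (preimage_size n f)"
    by (intro mono_onI) (simp only: preimage_size_def fib b_mono)
  moreover have "kernel_partition n k f = P"
  proof -
    have "kernel_partition n k f = b ` {1..k}"
      unfolding kernel_partition_def by (intro image_cong refl fib)
    also have "\<dots> = P"
      using b_in b_surj by blast
    finally show ?thesis .
  qed
  ultimately show ?thesis by blast
qed

lemma Stirling_le_U: "Stirling n k \<le> U n k"
proof -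
  have "parts_into {1..n} k
      \<subseteq> kernel_partition n k ` {f \<in> onto_funs n k. mono_on {1..k} (preimage_size n f)}"
    using ex_mono_onto_fun_of_partition by blast
  hence "card (parts_into {1..n} k) \<le> U n k"
    unfolding U_def by (intro surj_card_le) (simp_all add: finite_onto_funs)
  thus ?thesis by (simp add: card_parts_into)
qed

section \<open>The gap between \<open>U\<close> and \<open>T\<close>, and the limits\<close>

text \<open>Sizes that are monotone but not strictly so coincide at two distinct values. A union
  bound over the ordered pairs of distinct values, at most \<open>k^2\<close> of them, gives the
  factor in front.\<close>

lemma U_minus_T_le:
  "real (U n k) - real (T n k) \<le> real k ^ 2 * (real k ^ n * (1 + real k / 8) / sqrt (real n + 1))"
proof -
  define E where "E = (\<lambda>(i, j). {f \<in> {1..n} \<rightarrow>\<^sub>E {1..k}. preimage_size n f i = preimage_size n f j})"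
  define I where "I = {(i, j) \<in> {1..k} \<times> {1..k}. i \<noteq> j}"
  have finI: "finite I"
    by (rule finite_subset[of _ "{1..k} \<times> {1..k}"]) (auto simp: I_def)
  have finE: "finite (E p)" for p
    by (rule finite_subset[OF _ finite_PiE[of "{1..n}" "\<lambda>_. {1..k}"]]) (auto simp: E_def split: prod.splits)
  let ?T = "{f \<in> onto_funs n k. strict_mono_on {1..k} (preimage_size n f)}"
  have "{f \<in> onto_funs n k. mono_on {1..k} (preimage_size n f)} \<subseteq> ?T \<union> (\<Union>p\<in>I. E p)"
  proof
    fix f assume f: "f \<in> {f \<in> onto_funs n k. mono_on {1..k} (preimage_size n f)}"
    show "f \<in> ?T \<union> (\<Union>p\<in>I. E p)"
    proof (cases "strict_mono_on {1..k} (preimage_size n f)")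
      case False
      then obtain i j where ij: "i \<in> {1..k}" "j \<in> {1..k}" "i < j"
        "\<not> preimage_size n f i < preimage_size n f j"
        by (auto simp: monotone_on_def)
      moreover have "preimage_size n f i \<le> preimage_size n f j"
        using f ij mono_onD[of "{1..k}" "preimage_size n f" i j] by simp
      ultimately have "f \<in> E (i, j)" "(i, j) \<in> I"
        using f by (auto simp: E_def I_def onto_funs_def)
      thus ?thesis by blast
    qed (use f in simp)
  qed
  hence "U n k \<le> card (?T \<union> (\<Union>p\<in>I. E p))"
    unfolding U_def by (intro card_mono) (simp_all add: finite_onto_funs finI finE)
  also have "\<dots> \<le> T n k + card (\<Union>p\<in>I. E p)"
    unfolding T_def by (rule card_Un_le)
  also have "\<dots> \<le> T n k + (\<Sum>p\<in>I. card (E p))"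
    using card_UN_le[OF finI] by simp
  finally have "real (U n k) \<le> real (T n k + (\<Sum>p\<in>I. card (E p)))"
    by (rule of_nat_mono)
  hence "real (U n k) - real (T n k) \<le> (\<Sum>p\<in>I. real (card (E p)))"
    by simp
  also have "\<dots> \<le> real (card I) * (real k ^ n * (1 + real k / 8) / sqrt (real n + 1))"
  proof (rule sum_bounded_above)
    fix p assume "p \<in> I"
    then obtain i j where "p = (i, j)" "i \<in> {1..k}" "j \<in> {1..k}" "i \<noteq> j"
      unfolding I_def by blast
    thus "real (card (E p)) \<le> real k ^ n * (1 + real k / 8) / sqrt (real n + 1)"
      using card_equal_preimage_sizes_le[of i k j n] by (simp add: E_def)
  qed
  also have "\<dots> \<le> real k ^ 2 * (real k ^ n * (1 + real k / 8) / sqrt (real n + 1))"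
  proof (rule mult_right_mono)
    have "card I \<le> card ({1..k} \<times> {1..k})"
      by (rule card_mono) (auto simp: I_def)
    hence "card I \<le> k ^ 2" by (simp add: power2_eq_square)
    thus "real (card I) \<le> real k ^ 2" by (simp only: of_nat_le_iff flip: of_nat_power)
  qed simp
  finally show ?thesis .
qed

theorem corollary3:
  fixes k :: nat
  assumes "k \<ge> 3"
  shows "(\<lambda>n. real (T n k) / real (Stirling n k)) \<longlonglongrightarrow> 1
    \<and> (\<lambda>n. real (U n k) / real (Stirling n k)) \<longlonglongrightarrow> 1"
proof -
  \<comment> \<open>The factor \<open>k ^ k\<close> pays for the passage from \<open>k ^ n\<close>
    to the lower bound \<open>k ^ (n - k)\<close> of the Stirling number; the rest is the constant
    from \<open>U_minus_T_le\<close>.\<close>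
  define c where "c = real k ^ k * (real k ^ 2 * (1 + real k / 8))"
  have lim: "(\<lambda>n. c / sqrt (real n + 1)) \<longlonglongrightarrow> 0"
    using filterlim_tendsto_add_at_top[OF tendsto_const filterlim_real_sequentially, of 1]
    by (intro tendsto_divide_0[OF tendsto_const] filterlim_at_top_imp_at_infinity
        filterlim_compose[OF sqrt_at_top]) (simp add: add.commute)
  have gap: "(real (U n k) - real (T n k)) / real (Stirling n k) \<le> c / sqrt (real n + 1)"
    and pos: "real (Stirling n k) > 0" if "n \<ge> k" for n
  proof -
    have "k ^ (n - k) \<le> Stirling n k"
      using Stirling_ge_power[of k "n - k"] that by simp
    hence S: "real k ^ (n - k) \<le> real (Stirling n k)"
      by (simp only: of_nat_le_iff flip: of_nat_power)
    have "0 < real k ^ (n - k)" using assms by simp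
    thus pos: "real (Stirling n k) > 0" using S by linarith
    have "real (U n k) - real (T n k)
        \<le> real k ^ 2 * (real k ^ n * (1 + real k / 8) / sqrt (real n + 1))"
      by (rule U_minus_T_le)
    also have "real k ^ n = real k ^ k * real k ^ (n - k)"
      using that by (simp flip: power_add)
    also have "real k ^ 2 * (real k ^ k * real k ^ (n - k) * (1 + real k / 8) / sqrt (real n + 1))
        = c / sqrt (real n + 1) * real k ^ (n - k)"
      by (simp add: c_def)
    also have "\<dots> \<le> c / sqrt (real n + 1) * real (Stirling n k)"
      using S by (intro mult_left_mono) (simp_all add: c_def)
    finally show "(real (U n k) - real (T n k)) / real (Stirling n k) \<le> c / sqrt (real n + 1)"
      using pos by (simp add: pos_divide_le_eq)
  qed
  have le: "real (T n k) \<le> real (Stirling n k)" "real (Stirling n k) \<le> real (U n k)" for n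
    using T_le_Stirling Stirling_le_U by simp_all
  \<comment> \<open>Since \<open>T \<le> Stirling \<le> U\<close>, the distance of either ratio from
    1 is at most the whole gap \<open>U - T\<close> divided by the Stirling number.\<close>
  have T_lower: "1 - c / sqrt (real n + 1) \<le> real (T n k) / real (Stirling n k)"
    and T_upper: "real (T n k) / real (Stirling n k) \<le> 1"
    and U_lower: "1 \<le> real (U n k) / real (Stirling n k)"
    and U_upper: "real (U n k) / real (Stirling n k) \<le> 1 + c / sqrt (real n + 1)"
    if "n \<ge> k" for n
  proof -
    note S = pos[OF that]
    show T1: "real (T n k) / real (Stirling n k) \<le> 1" and U1: "1 \<le> real (U n k) / real (Stirling n k)"
      using S le[of n] by simp_all
    show "1 - c / sqrt (real n + 1) \<le> real (T n k) / real (Stirling n k)"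
      and "real (U n k) / real (Stirling n k) \<le> 1 + c / sqrt (real n + 1)"
      using gap[OF that] T1 U1 by (simp_all only: diff_divide_distrib)
  qed
  have "(\<lambda>n. real (T n k) / real (Stirling n k)) \<longlonglongrightarrow> 1"
  proof (rule tendsto_sandwich[where h = "\<lambda>_. 1"])
    show "(\<lambda>n. 1 - c / sqrt (real n + 1)) \<longlonglongrightarrow> 1"
      using tendsto_diff[OF tendsto_const lim, of 1] by simp
  qed (use T_lower T_upper in \<open>auto simp: eventually_at_top_linorder\<close>)
  moreover have "(\<lambda>n. real (U n k) / real (Stirling n k)) \<longlonglongrightarrow> 1"
  proof (rule tendsto_sandwich[where f = "\<lambda>_. 1"])
    show "(\<lambda>n. 1 + c / sqrt (real n + 1)) \<longlonglongrightarrow> 1"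
      using tendsto_add[OF tendsto_const lim, of 1] by simp
  qed (use U_lower U_upper in \<open>auto simp: eventually_at_top_linorder\<close>)
  ultimately show ?thesis ..
qed

end
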